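(* Let $(X,d)$ be a nonempty compact metric space. If $T:X\to X$ is a contractive continuous map, i.e. $d(T(x),T(y))<d(x,y)$ for all $x\neq y$ in $X$, then $D_{pre}(T)=0$.
   Context: For $n\in\mathbb{N}=\{1,2,\dots\}$ put $d_{T,n}(x,y)=\max_{0\le j<n}d(T^j(x),T^j(y))$. For $K\subseteq X$ and $\epsilon>0$, a set $E\subseteq K$ is an $(n,\epsilon,K,T)$-separated set if $d_{T,n}(x,y)>\epsilon$ for all $x\ne y$ in $E$; $r(n,\epsilon,K,T)$ denotes the maximal cardinality of an $(n,\epsilon,K,T)$-separated subset of $K$. Here $T^{-k}(x)=\{y\in X: T^k(y)=x\}$. For real $s>0$, the $s$-preimage entropy of $T$ is $$D_{pre}(s,T)=\lim_{\epsilon\to 0}\limsup_{n\to\infty}\frac{1}{n^s}\log\sup_{x\in X,\,k\ge n}r(n,\epsilon,T^{-k}(x),T)\in[0,+\infty],$$ and the preimage entropy dimension of $T$ is $$D_{pre}(T)=\inf\{s>0: D_{pre}(s,T)=0\}=\sup\{s>0: D_{pre}(s,T)=\infty\}\in[0,+\infty]$$ (with $\inf\emptyset=+\infty$ and $\sup\emptyset=0$). *)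

theory Defs
  imports "HOL-Analysis.Analysis"
begin

(* The compact metric space is a subset X of an ambient type of class metric_space, with the
   induced distance; only the values of T on X matter.

   The time n ranges over the positive integers.  At n = 0 the maximum below is over the empty
   set, hence unspecified; this value never influences the limsup in preimage_entropy. *)

definition bowen_dist :: "('a::metric_space \<Rightarrow> 'a) \<Rightarrow> nat \<Rightarrow> 'a \<Rightarrow> 'a \<Rightarrow> real" where
  "bowen_dist T n x y = Max ((\<lambda>j. dist ((T ^^ j) x) ((T ^^ j) y)) ` {..<n})"

definition separated_set ::
    "nat \<Rightarrow> real \<Rightarrow> 'a::metric_space set \<Rightarrow> ('a \<Rightarrow> 'a) \<Rightarrow> 'a set \<Rightarrow> bool" where
  "separated_set n \<epsilon> K T E \<longleftrightarrow>
     E \<subseteq> K \<and> (\<forall>x\<in>E. \<forall>y\<in>E. x \<noteq> y \<longrightarrow> bowen_dist T n x y > \<epsilon>)"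

(* Cardinalities are taken in enat, so that an infinite set does not get cardinality 0. *)
definition separation_number ::
    "nat \<Rightarrow> real \<Rightarrow> 'a::metric_space set \<Rightarrow> ('a \<Rightarrow> 'a) \<Rightarrow> enat" where
  "separation_number n \<epsilon> K T =
     (SUP E \<in> {E. separated_set n \<epsilon> K T E}. if finite E then enat (card E) else \<infinity>)"

definition iter_preimage :: "'a set \<Rightarrow> ('a \<Rightarrow> 'a) \<Rightarrow> nat \<Rightarrow> 'a \<Rightarrow> 'a set" where
  "iter_preimage X T k x = {y \<in> X. (T ^^ k) y = x}"

(* Natural logarithm with log 0 = -\<infinity> and log \<infinity> = \<infinity>. *)
definition enat_ln :: "enat \<Rightarrow> ereal" where
  "enat_ln m = (case m of enat k \<Rightarrow> if k = 0 then -\<infinity> else ereal (ln (real k)) | \<infinity> \<Rightarrow> \<infinity>)"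

(* The limit as \<epsilon> decreases to 0 is a limit of a monotone function, so it exists in ereal. *)
definition preimage_entropy ::
    "'a::metric_space set \<Rightarrow> real \<Rightarrow> ('a \<Rightarrow> 'a) \<Rightarrow> ereal" where
  "preimage_entropy X s T =
     Lim (at_right 0) (\<lambda>\<epsilon>::real.
       limsup (\<lambda>n. ereal (1 / real n powr s) *
         enat_ln (SUP (x, k) \<in> X \<times> {n..}. separation_number n \<epsilon> (iter_preimage X T k x) T)))"

(* In ereal the infimum of the empty set is \<infinity>. *)
definition preimage_entropy_dim :: "'a::metric_space set \<Rightarrow> ('a \<Rightarrow> 'a) \<Rightarrow> ereal" where
  "preimage_entropy_dim X T = Inf {ereal s | s. s > 0 \<and> preimage_entropy X s T = 0}"

end

theory Submission
  imports Defs
begin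

text \<open>A contractive map never increases distances along orbits, so the Bowen distance equals the
  original one. Separated sets are then bounded in size by a covering number of \<open>X\<close> that does not
  depend on \<open>n\<close>, and the logarithm of a bounded quantity is killed by \<open>1 / n\<^sup>s\<close> for every \<open>s > 0\<close>.\<close>

lemma funpow_in:
  assumes "T \<in> X \<rightarrow> X" "x \<in> X"
  shows "(T ^^ j) x \<in> X"
  using assms by (induction j) auto

text \<open>Iterating the inequality shows that no later time exceeds time 0, so the maximum is
  attained at \<open>j = 0\<close>; that index is in range because \<open>n > 0\<close>.\<close>

lemma bowen_dist_nonexpansive:
  assumes T: "T \<in> X \<rightarrow> X"
    and le: "\<And>x y. x \<in> X \<Longrightarrow> y \<in> X \<Longrightarrow> dist (T x) (T y) \<le> dist x y"
    and "x \<in> X" "y \<in> X" "n > 0"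
  shows "bowen_dist T n x y = dist x y"
proof -
  have "dist ((T ^^ j) x) ((T ^^ j) y) \<le> dist x y" for j
  proof (induction j)
    case (Suc j)
    then show ?case
      using le[of "(T ^^ j) x" "(T ^^ j) y"] funpow_in[OF T] assms(3,4) by force
  qed simp
  moreover have "dist x y \<in> (\<lambda>j. dist ((T ^^ j) x) ((T ^^ j) y)) ` {..<n}"
    using \<open>n > 0\<close> by (intro image_eqI[of _ _ 0]) auto
  ultimately show ?thesis
    unfolding bowen_dist_def by (intro Max_eqI) auto
qed

text \<open>Total boundedness covers \<open>X\<close> by finitely many balls of radius
  \<open>\<epsilon> / 2\<close>. Two points in one ball are less than \<open>\<epsilon>\<close>
  apart, so sending each point of \<open>E\<close> to a centre near it is injective, and the number
  of centres serves as \<open>N\<close>.\<close>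

lemma compact_separated_card_bound:
  fixes X :: "'a::metric_space set"
  assumes "compact X" "\<epsilon> > 0"
  obtains N where "\<And>E. E \<subseteq> X \<Longrightarrow> (\<And>x y. x \<in> E \<Longrightarrow> y \<in> E \<Longrightarrow> x \<noteq> y \<Longrightarrow> dist x y > \<epsilon>)
      \<Longrightarrow> finite E \<and> card E \<le> N"
proof -
  obtain F where F: "finite F" "X \<subseteq> (\<Union>c\<in>F. ball c (\<epsilon> / 2))"
    using seq_compact_imp_totally_bounded[OF compact_imp_seq_compact[OF assms(1)]] assms(2)
    by (meson half_gt_zero)
  have "finite E \<and> card E \<le> card F"
    if E: "E \<subseteq> X" and sep: "\<And>x y. x \<in> E \<Longrightarrow> y \<in> E \<Longrightarrow> x \<noteq> y \<Longrightarrow> dist x y > \<epsilon>" for E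
  proof -
    have "\<forall>x\<in>E. \<exists>c\<in>F. dist c x < \<epsilon> / 2"
      using E F(2) by fastforce
    then obtain c where c: "\<And>x. x \<in> E \<Longrightarrow> c x \<in> F" "\<And>x. x \<in> E \<Longrightarrow> dist (c x) x < \<epsilon> / 2"
      by metis
    have "inj_on c E"
    proof (rule inj_onI)
      fix x y assume xy: "x \<in> E" "y \<in> E" "c x = c y"
      have "dist x y < \<epsilon>"
        using dist_triangle_half_r[of "c x" x \<epsilon> y] c(2) xy by metis
      then show "x = y"
        using sep[OF xy(1,2)] by force
    qed
    then show ?thesis
      using c(1) F(1) by (metis card_inj_on_le image_subsetI inj_on_finite)
  qed
  then show thesis by (rule that)
qed

lemma limsup_enat_ln_over_powr_eq_0:
  assumes "s > 0"
    and ev: "eventually (\<lambda>n. 1 \<le> a n \<and> a n \<le> enat N) sequentially"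
  shows "limsup (\<lambda>n. ereal (1 / real n powr s) * enat_ln (a n)) = 0"
proof -
  \<comment> \<open>The lower bound on \<open>m\<close> excludes the value
    \<open>-\<infinity>\<close> at 0, the upper bound excludes \<open>\<infinity>\<close>.\<close>
  have bnd: "0 \<le> enat_ln m \<and> enat_ln m \<le> ereal (ln (real N))" if "1 \<le> m" "m \<le> enat N" for m
    using that by (cases m) (auto simp: enat_ln_def one_enat_def)
  have "(\<lambda>n. ereal (1 / real n powr s) * enat_ln (a n)) \<longlonglongrightarrow> 0"
  proof (rule tendsto_sandwich)
    show "eventually (\<lambda>n. 0 \<le> ereal (1 / real n powr s) * enat_ln (a n)) sequentially"
      using ev by eventually_elim (simp add: bnd)
    show "eventually (\<lambda>n. ereal (1 / real n powr s) * enat_ln (a n)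
        \<le> ereal (1 / real n powr s * ln (real N))) sequentially"
      using ev
    proof eventually_elim
      case (elim n)
      then have "ereal (1 / real n powr s) * enat_ln (a n)
          \<le> ereal (1 / real n powr s) * ereal (ln (real N))"
        using bnd[of "a n"] by (intro ereal_mult_left_mono) auto
      then show ?case by simp
    qed
    have "(\<lambda>n. real n powr - s) \<longlonglongrightarrow> 0"
      using assms(1) by (intro tendsto_neg_powr filterlim_real_sequentially) auto
    then have "(\<lambda>n. 1 / real n powr s * ln (real N)) \<longlonglongrightarrow> 0"
      by (simp only: powr_minus_divide tendsto_mult_left_zero)
    then show "(\<lambda>n. ereal (1 / real n powr s * ln (real N))) \<longlonglongrightarrow> 0"
      by (simp add: zero_ereal_def)
  qed simp
  then show ?thesis
    by (intro lim_imp_Limsup) auto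
qed

lemma preimage_entropy_nonexpansive:
  fixes X :: "'a::metric_space set"
  assumes "compact X" "X \<noteq> {}" and T: "T \<in> X \<rightarrow> X"
    and le: "\<And>x y. x \<in> X \<Longrightarrow> y \<in> X \<Longrightarrow> dist (T x) (T y) \<le> dist x y"
    and "s > 0"
  shows "preimage_entropy X s T = 0"
proof -
  define r where "r = (\<lambda>n \<epsilon>. SUP (x, k) \<in> X \<times> {n..}. separation_number n \<epsilon> (iter_preimage X T k x) T)"
  have "limsup (\<lambda>n. ereal (1 / real n powr s) * enat_ln (r n \<epsilon>)) = 0" if "\<epsilon> > 0" for \<epsilon>
  proof -
    \<comment> \<open>\<open>N\<close> depends on \<open>\<epsilon>\<close> only: it is fixed before
      \<open>n\<close>, \<open>k\<close> and the base point of the fibre.\<close>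
    obtain N where N: "\<And>E. E \<subseteq> X \<Longrightarrow> (\<And>x y. x \<in> E \<Longrightarrow> y \<in> E \<Longrightarrow> x \<noteq> y \<Longrightarrow> dist x y > \<epsilon>)
        \<Longrightarrow> finite E \<and> card E \<le> N"
      using compact_separated_card_bound[OF \<open>compact X\<close> \<open>\<epsilon> > 0\<close>] by metis
    \<comment> \<open>At \<open>n = 0\<close> the Bowen distance is an unspecified
      \<open>Max {}\<close>, so the bound is claimed for positive times only; the limsup does not
      see the difference.\<close>
    have upper: "r n \<epsilon> \<le> enat N" if "n > 0" for n
    proof -
      have "finite E \<and> card E \<le> N" if "separated_set n \<epsilon> (iter_preimage X T k x) T E" for k x E
      proof (rule N)
        show EX: "E \<subseteq> X"
          using that by (auto simp: separated_set_def iter_preimage_def)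
        show "dist u v > \<epsilon>" if "u \<in> E" "v \<in> E" "u \<noteq> v" for u v
        proof -
          have "bowen_dist T n u v = dist u v"
            using bowen_dist_nonexpansive[OF T le] EX that(1,2) \<open>n > 0\<close> by blast
          then show ?thesis
            using \<open>separated_set n \<epsilon> _ T E\<close> that by (metis separated_set_def)
        qed
      qed
      then show ?thesis
        unfolding r_def separation_number_def by (auto intro!: SUP_least)
    qed
    have lower: "1 \<le> r n \<epsilon>" for n
    proof -
      \<comment> \<open>Fibres may be empty when \<open>T\<close> is not surjective. The fibre of
        \<open>T ^^ n\<close> over \<open>(T ^^ n) x\<close> contains \<open>x\<close>, and
        \<open>k = n\<close> is an admissible depth, so a singleton gives the bound.\<close>
      obtain x where x: "x \<in> X" using \<open>X \<noteq> {}\<close> by blast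
      have sep: "separated_set n \<epsilon> (iter_preimage X T n ((T ^^ n) x)) T {x}"
        using x by (simp add: separated_set_def iter_preimage_def)
      have "1 \<le> separation_number n \<epsilon> (iter_preimage X T n ((T ^^ n) x)) T"
        unfolding separation_number_def
        by (rule SUP_upper2[of "{x}"]) (use sep in \<open>auto simp: one_enat_def\<close>)
      also have "\<dots> \<le> r n \<epsilon>"
        unfolding r_def
        by (rule SUP_upper2[of "((T ^^ n) x, n)"]) (use funpow_in[OF T x] in auto)
      finally show ?thesis .
    qed
    show ?thesis
      by (rule limsup_enat_ln_over_powr_eq_0[OF \<open>s > 0\<close>, of _ N])
        (use upper lower in \<open>auto intro: eventually_mono[OF eventually_gt_at_top[of 0]]\<close>)
  qed
  \<comment> \<open>The limsup vanishes for each \<open>\<epsilon> > 0\<close>, so the limit is that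
    of a function constant to the right of 0.\<close>
  then have "((\<lambda>\<epsilon>. limsup (\<lambda>n. ereal (1 / real n powr s) * enat_ln (r n \<epsilon>))) \<longlongrightarrow> 0) (at_right 0)"
    by (intro tendsto_eventually) (auto simp: eventually_at_filter)
  then show ?thesis
    unfolding preimage_entropy_def r_def by (intro tendsto_Lim) auto
qed

theorem proposition2p5:
  fixes X :: "'a::metric_space set" and T :: "'a \<Rightarrow> 'a"
  assumes "compact X" and "X \<noteq> {}"
    and "T \<in> X \<rightarrow> X"
    and "continuous_on X T"
    and "\<And>x y. x \<in> X \<Longrightarrow> y \<in> X \<Longrightarrow> x \<noteq> y \<Longrightarrow> dist (T x) (T y) < dist x y"
  shows "preimage_entropy_dim X T = 0"
proof -
  \<comment> \<open>Contraction speaks of distinct points; for \<open>x = y\<close> both distances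
    are 0.\<close>
  have "dist (T x) (T y) \<le> dist x y" if "x \<in> X" "y \<in> X" for x y
    using assms(5)[OF that] by (cases "x = y") auto
  then have "preimage_entropy X s T = 0" if "s > 0" for s
    using preimage_entropy_nonexpansive assms(1-3) that by blast
  then have "preimage_entropy_dim X T = Inf {ereal s | s. s > 0}"
    unfolding preimage_entropy_dim_def by (metis (lifting))
  also have "\<dots> = 0"
  proof (rule antisym)
    show "Inf {ereal s | s. s > 0} \<le> 0"
      \<comment> \<open>The infimum 0 is not attained, but every positive real belongs to the set
        and so bounds the infimum from above.\<close>
      by (rule ereal_le_epsilon2) (auto intro: Inf_lower)
  qed (auto intro: Inf_greatest)
  finally show ?thesis .
qed

end
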